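(* Let $p,n\in\mathbb N$ with $p\ge n\ge 15$, and write $p=k(n-1)+r$ with $k\in\mathbb N$ and $r\in\{3,4,\ldots,n-9\}$. Then $$\mathrm{ex}(p;T_n^3)=\frac{(n-2)p-r(n-1-r)}2+\max\Big\{0,\Big\lfloor\frac{r(n-4-r)-3(n-1)}2\Big\rfloor\Big\}.$$
   Context: All graphs are finite simple graphs. For a graph $L$, $\mathrm{ex}(p;L)$ denotes the maximum number of edges in a graph on $p$ vertices that contains no subgraph isomorphic to $L$. For $n\ge 6$, $T_n^3$ is the tree on vertex set $\{v_0,\ldots,v_{n-1}\}$ with edge set $\{v_0v_1,v_0v_2,\ldots,v_0v_{n-4},\ v_1v_{n-3},\ v_1v_{n-2},\ v_1v_{n-1}\}$. $\lfloor x\rfloor$ is the greatest integer not exceeding $x$; $\mathbb N=\{1,2,\ldots\}$. *)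

theory Defs
  imports Complex_Main
begin

definition simple_graph :: "'a set \<Rightarrow> 'a set set \<Rightarrow> bool" where
  "simple_graph V E \<longleftrightarrow> finite V \<and> (\<forall>e\<in>E. e \<subseteq> V \<and> card e = 2)"

definition contains_copy :: "'a set \<Rightarrow> 'a set set \<Rightarrow> 'b set \<Rightarrow> 'b set set \<Rightarrow> bool" where
  "contains_copy V E VL EL \<longleftrightarrow>
     (\<exists>f. inj_on f VL \<and> f ` VL \<subseteq> V \<and> (\<forall>e\<in>EL. f ` e \<in> E))"

definition ex :: "nat \<Rightarrow> 'b set \<Rightarrow> 'b set set \<Rightarrow> nat" where
  "ex p VL EL = Max {card E | E. simple_graph {0..<p} E \<and> \<not> contains_copy {0..<p} E VL EL}"

definition T3_vertices :: "nat \<Rightarrow> nat set" where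
  "T3_vertices n = {0..<n}"

definition T3_edges :: "nat \<Rightarrow> nat set set" where
  "T3_edges n = {{0, i} | i. 1 \<le> i \<and> i \<le> n - 4} \<union> {{1, n - 3}, {1, n - 2}, {1, n - 1}}"

end

theory Submission
  imports Defs
begin

text \<open>
  Put \<open>N = n - 1\<close>. Up to parity, an upper bound on the number of edges is a lower bound
  \<open>min (r (N - r)) (3 (N + r))\<close> on the deficiency, the sum of \<open>N - 1 - deg v\<close> over all vertices.
  The tree is a double star, so it embeds at an edge \<open>uv\<close> as soon as \<open>deg u \<ge> N - 3\<close>, \<open>deg v \<ge> 4\<close>
  and the two neighbourhoods together have more than \<open>N\<close> vertices. Hence the closed neighbourhood
  of a vertex of degree at least \<open>N - 2\<close> has few edges leaving it, and from it one finds \<open>N\<close>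
  vertices whose removal does not increase the deficiency. Once all degrees are at most \<open>N - 3\<close>,
  the deficiency is at least twice the number of vertices, which suffices unless exactly \<open>N + r\<close>
  vertices are left. In that case a vertex \<open>u\<close> of degree \<open>N - 3\<close> splits the graph into its
  closed neighbourhood and a part of \<open>r + 2\<close> vertices, whose own deficiency is large because
  \<open>3 \<le> r \<le> N - 8\<close>.
  The extremal graphs are disjoint copies of \<open>K\<^sub>N\<close> together with either \<open>K\<^sub>r\<close> or a nearly
  \<open>(N - 4)\<close>-regular graph on \<open>N + r\<close> vertices.
\<close>

section \<open>Neighbourhoods, deficiency and the local form of tree-freeness\<close>

locale adjacency =
  fixes adj :: "'a \<Rightarrow> 'a \<Rightarrow> bool"
  assumes adj_sym: "adj x y \<Longrightarrow> adj y x"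
    and adj_irrefl: "\<not> adj x x"
begin

definition nbh :: "'a set \<Rightarrow> 'a \<Rightarrow> 'a set" where
  "nbh W v = {w \<in> W. adj v w}"

text \<open>Integer-valued, because a vertex of degree \<open>N\<close> or more contributes a
  negative amount. A component that is a clique on \<open>N\<close> vertices contributes 0.\<close>

definition deficiency :: "nat \<Rightarrow> 'a set \<Rightarrow> int" where
  "deficiency N W = (\<Sum>v\<in>W. int N - 1 - int (card (nbh W v)))"

text \<open>A violating edge \<open>u v\<close> is one where the double star fits: degree
  \<open>N - 3\<close> for one centre, degree 4 for the other, and room for all \<open>N + 1\<close>
  vertices. The additive form avoids truncated subtraction.\<close>

definition tree_free :: "nat \<Rightarrow> 'a set \<Rightarrow> bool" where
  "tree_free N W \<longleftrightarrow> (\<forall>u\<in>W. \<forall>v\<in>W. adj u v \<longrightarrow> N \<le> card (nbh W u) + 3 \<longrightarrow>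
     4 \<le> card (nbh W v) \<longrightarrow> card (nbh W u \<union> nbh W v) \<le> N)"

lemma nbh_subset: "nbh W v \<subseteq> W"
  by (auto simp: nbh_def)

lemma finite_nbh [simp]: "finite W \<Longrightarrow> finite (nbh W v)"
  by (simp add: nbh_def)

lemma card_nbh_mono: "finite W \<Longrightarrow> W' \<subseteq> W \<Longrightarrow> card (nbh W' v) \<le> card (nbh W v)"
  by (intro card_mono) (auto simp: nbh_def)

lemma card_nbh_less:
  assumes "finite W" "v \<in> W"
  shows "card (nbh W v) < card W"
proof -
  have "nbh W v \<subset> W" using assms adj_irrefl by (auto simp: nbh_def)
  then show ?thesis using assms by (simp add: psubset_card_mono)
qed

text \<open>Degrees only drop in \<open>W'\<close>, so an edge meeting the degree conditions there
  meets them in \<open>W\<close>. This lets the later induction delete vertices.\<close>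

lemma tree_free_mono:
  assumes "tree_free N W" "finite W" "W' \<subseteq> W"
  shows "tree_free N W'"
  unfolding tree_free_def
proof (intro ballI impI)
  fix u v
  assume uv: "u \<in> W'" "v \<in> W'" "adj u v" "N \<le> card (nbh W' u) + 3" "4 \<le> card (nbh W' v)"
  have "card (nbh W u \<union> nbh W v) \<le> N"
    using assms(1) uv card_nbh_mono[OF assms(2,3), of u] card_nbh_mono[OF assms(2,3), of v] assms(3)
    unfolding tree_free_def by (meson le_trans add_le_mono1 subsetD)
  moreover have "card (nbh W' u \<union> nbh W' v) \<le> card (nbh W u \<union> nbh W v)"
    by (rule card_mono) (use assms in \<open>auto simp: nbh_def\<close>)
  ultimately show "card (nbh W' u \<union> nbh W' v) \<le> N" by simp
qed

lemma sum_card_nbh_swap: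
  assumes "finite A" "finite B"
  shows "(\<Sum>v\<in>A. card (nbh B v)) = (\<Sum>v\<in>B. card (nbh A v))"
proof -
  have "(\<Sum>v\<in>A. card (nbh B v)) = (\<Sum>v\<in>A. \<Sum>w\<in>B. if adj v w then 1 else 0)"
    using assms by (intro sum.cong refl) (simp add: nbh_def sum.If_cases Int_def)
  also have "\<dots> = (\<Sum>w\<in>B. \<Sum>v\<in>A. if adj v w then 1 else 0)"
    by (rule sum.swap)
  also have "\<dots> = (\<Sum>w\<in>B. \<Sum>v\<in>A. if adj w v then 1 else 0)"
    using adj_sym by (intro sum.cong refl) metis
  also have "\<dots> = (\<Sum>v\<in>B. card (nbh A v))"
    using assms by (intro sum.cong refl) (simp add: nbh_def sum.If_cases Int_def)
  finally show ?thesis .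
qed

text \<open>Each edge leaving \<open>S\<close> also lowers the degree of its endpoint in
  \<open>W - S\<close>. Double counting charges that loss to the endpoint in \<open>S\<close>, hence
  the second subtracted term.\<close>

lemma deficiency_Diff:
  assumes "finite W" "S \<subseteq> W"
  shows "deficiency N W = deficiency N (W - S) +
    (\<Sum>v\<in>S. int N - 1 - int (card (nbh W v)) - int (card (nbh (W - S) v)))"
proof -
  have fin: "finite S" "finite (W - S)" using assms finite_subset by auto
  have part: "card (nbh W v) = card (nbh (W - S) v) + card (nbh S v)" for v
  proof -
    have "nbh W v = nbh (W - S) v \<union> nbh S v" "nbh (W - S) v \<inter> nbh S v = {}"
      using assms(2) by (auto simp: nbh_def)
    then show ?thesis using fin by (simp add: card_Un_disjoint)
  qed
  have sw: "(\<Sum>v\<in>W - S. int (card (nbh S v))) = (\<Sum>v\<in>S. int (card (nbh (W - S) v)))"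
    using sum_card_nbh_swap[OF fin(2,1)] by (metis of_nat_sum)
  have "deficiency N W = (\<Sum>v\<in>W - S. int N - 1 - int (card (nbh W v))) +
      (\<Sum>v\<in>S. int N - 1 - int (card (nbh W v)))"
    unfolding deficiency_def using assms by (simp add: sum.subset_diff)
  also have "(\<Sum>v\<in>W - S. int N - 1 - int (card (nbh W v))) =
      deficiency N (W - S) - (\<Sum>v\<in>W - S. int (card (nbh S v)))"
    unfolding deficiency_def sum_subtractf[symmetric]
    by (intro sum.cong refl) (simp add: part)
  finally show ?thesis using sw by (simp add: sum_subtractf)
qed

lemma deficiency_remove1:
  assumes "finite W" "x \<in> W"
  shows "deficiency N W = deficiency N (W - {x}) + int N - 1 - 2 * int (card (nbh W x))"
proof -
  have "nbh (W - {x}) x = nbh W x" using adj_irrefl by (auto simp: nbh_def)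
  then show ?thesis using deficiency_Diff[of W "{x}" N] assms by simp
qed

lemma deficiency_ge_mult:
  assumes "\<And>v. v \<in> W \<Longrightarrow> int (card (nbh W v)) + c \<le> int N - 1"
  shows "c * int (card W) \<le> deficiency N W"
proof -
  have "(\<Sum>v\<in>W. c) \<le> deficiency N W"
    unfolding deficiency_def by (intro sum_mono) (use assms in force)
  then show ?thesis by (simp add: mult.commute)
qed

lemma deficiency_ge_clique:
  assumes "finite W"
  shows "int (card W) * (int N - int (card W)) \<le> deficiency N W"
proof -
  have "(int N - int (card W)) * int (card W) \<le> deficiency N W"
    by (rule deficiency_ge_mult) (use assms card_nbh_less in force)
  then show ?thesis by (simp add: mult.commute)
qed

section \<open>Removing \<open>N\<close> vertices around a vertex of large degree\<close>

lemma card_closed_nbh: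
  "finite W \<Longrightarrow> card (insert u (nbh W u)) = card (nbh W u) + 1"
  using adj_irrefl by (simp add: nbh_def)

text \<open>The vertex \<open>u\<close> is a neighbour of \<open>v\<close> inside \<open>A\<close>,
  which gives the first claim. If \<open>v\<close> has degree at least 4, then
  \<open>tree_free\<close> applies to \<open>u v\<close>, whose neighbourhoods together cover
  \<open>A\<close> and all neighbours of \<open>v\<close> outside \<open>A\<close>.\<close>

lemma nbh_outside_closed_nbh:
  assumes "tree_free N W" "finite W" "u \<in> W" "v \<in> nbh W u" "N \<le> card (nbh W u) + 3"
  defines "A \<equiv> insert u (nbh W u)"
  shows "card (nbh (W - A) v) + 1 \<le> card (nbh W v)"
    and "card (nbh W v) \<le> 3 \<or> card (nbh W u) + 1 + card (nbh (W - A) v) \<le> N"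
proof -
  have uv: "adj u v" "v \<in> W" "u \<in> nbh W v" using assms(3,4) adj_sym by (auto simp: nbh_def)
  have "insert u (nbh (W - A) v) \<subseteq> nbh W v" using uv by (auto simp: nbh_def)
  moreover have u: "u \<notin> nbh (W - A) v" by (auto simp: nbh_def A_def)
  ultimately show "card (nbh (W - A) v) + 1 \<le> card (nbh W v)"
    using assms(2) card_mono[of "nbh W v" "insert u (nbh (W - A) v)"] by simp
  show "card (nbh W v) \<le> 3 \<or> card (nbh W u) + 1 + card (nbh (W - A) v) \<le> N"
  proof (rule disjCI)
    assume "\<not> card (nbh W u) + 1 + card (nbh (W - A) v) \<le> N"
    moreover have "nbh W u \<union> nbh W v \<supseteq> A \<union> nbh (W - A) v" 
      using uv by (auto simp: A_def nbh_def)
    then have "card (A \<union> nbh (W - A) v) \<le> card (nbh W u \<union> nbh W v)"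
      using assms(2) by (intro card_mono) auto
    moreover have "card (A \<union> nbh (W - A) v) = card A + card (nbh (W - A) v)"
      using assms(2) by (intro card_Un_disjoint) (auto simp: A_def nbh_def)
    ultimately have "\<not> card (nbh W u \<union> nbh W v) \<le> N"
      using card_closed_nbh[OF assms(2), of u] by (simp add: A_def)
    then have "\<not> 4 \<le> card (nbh W v)"
      using assms(1,3,5) uv unfolding tree_free_def by blast
    then show "card (nbh W v) \<le> 3" by simp
  qed
qed

text \<open>Only an inequality, since \<open>y\<close> may lose the neighbour \<open>x\<close>
  before it is removed itself.\<close>

lemma deficiency_remove_pair:
  assumes "finite W" "x \<in> W" "y \<in> W" "x \<noteq> y"
  shows "deficiency N W \<ge> deficiency N (W - {x, y}) + 2 * int N - 2
     - 2 * int (card (nbh W x)) - 2 * int (card (nbh W y))"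
proof -
  have e: "W - {x} - {y} = W - {x, y}" by auto
  show ?thesis
    using deficiency_remove1[of W x N] deficiency_remove1[of "W - {x}" y N]
      card_nbh_mono[of W "W - {x}" y] assms e by auto
qed

text \<open>Every neighbour of \<open>u\<close> has degree at most 3, so any \<open>N\<close> of
  them can go; \<open>u\<close> itself stays behind.\<close>

lemma reduction_large:
  assumes "tree_free N W" "finite W" "N \<ge> 14" "u \<in> W" "N \<le> card (nbh W u)"
  shows "\<exists>S\<subseteq>W. card S = N \<and> deficiency N (W - S) \<le> deficiency N W"
proof -
  obtain S where S: "S \<subseteq> nbh W u" "card S = N" "finite S"
    using obtain_subset_with_card_n[OF assms(5)] by metis
  have SW: "S \<subseteq> W" using S(1) nbh_subset by blast
  have "0 \<le> (\<Sum>v\<in>S. int N - 1 - int (card (nbh W v)) - int (card (nbh (W - S) v)))"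
  proof (rule sum_nonneg)
    fix v assume "v \<in> S"
    then have "v \<in> nbh W u" using S by auto
    then have "card (nbh W v) \<le> 3"
      using nbh_outside_closed_nbh(2)[OF assms(1,2,4)] assms(5) by fastforce
    moreover have "card (nbh (W - S) v) \<le> card (nbh W v)"
      using assms(2) by (intro card_nbh_mono) auto
    ultimately show "0 \<le> int N - 1 - int (card (nbh W v)) - int (card (nbh (W - S) v))"
      using assms(3) by linarith
  qed
  then have "deficiency N (W - S) \<le> deficiency N W"
    using deficiency_Diff[OF assms(2) SW, of N] by simp
  then show ?thesis using S SW by blast
qed

text \<open>The closed neighbourhood has exactly \<open>N\<close> vertices. A neighbour of
  \<open>u\<close> has no edge leaving it unless its degree is at most 3, so no summand is
  negative.\<close>

lemma reduction_N_minus_1: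
  assumes "tree_free N W" "finite W" "N \<ge> 14" "u \<in> W" "card (nbh W u) + 1 = N"
    and "\<And>v. v \<in> W \<Longrightarrow> card (nbh W v) + 1 \<le> N"
  shows "\<exists>S\<subseteq>W. card S = N \<and> deficiency N (W - S) \<le> deficiency N W"
proof -
  define A where "A = insert u (nbh W u)"
  have AW: "A \<subseteq> W" using assms(4) nbh_subset by (auto simp: A_def)
  have cA: "card A = N" using card_closed_nbh[OF assms(2)] assms(5) by (simp add: A_def)
  have "0 \<le> (\<Sum>v\<in>A. int N - 1 - int (card (nbh W v)) - int (card (nbh (W - A) v)))"
  proof (rule sum_nonneg)
    fix v assume v: "v \<in> A"
    show "0 \<le> int N - 1 - int (card (nbh W v)) - int (card (nbh (W - A) v))"
    proof (cases "v = u")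
      case True
      then have "nbh (W - A) v = {}" by (auto simp: A_def nbh_def)
      then show ?thesis using assms(5) True by simp
    next
      case False
      then have vu: "v \<in> nbh W u" using v by (simp add: A_def)
      show ?thesis
        using nbh_outside_closed_nbh[OF assms(1,2,4) vu, folded A_def] assms(3,5)
          assms(6)[OF subsetD[OF AW v]] by linarith
    qed
  qed
  then have "deficiency N (W - A) \<le> deficiency N W"
    using deficiency_Diff[OF assms(2) AW, of N] by simp
  then show ?thesis using cA AW by blast
qed

text \<open>The closed neighbourhood \<open>A\<close> is one vertex short of \<open>N\<close>; the
  work lies in choosing the extra vertex.\<close>

lemma reduction_N_minus_2:
  assumes "tree_free N W" "finite W" "N \<ge> 14" "u \<in> W" "card (nbh W u) + 2 = N" "N \<le> card W"
    and deg: "\<And>v. v \<in> W \<Longrightarrow> card (nbh W v) + 2 \<le> N"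
  shows "\<exists>S\<subseteq>W. card S = N \<and> deficiency N (W - S) \<le> deficiency N W"
proof -
  define A where "A = insert u (nbh W u)"
  define loss where "loss v = int N - 1 - int (card (nbh W v)) - int (card (nbh (W - A) v))" for v
  have AW: "A \<subseteq> W" using assms(4) nbh_subset by (auto simp: A_def)
  have finA: "finite A" using AW assms(2) finite_subset by blast
  have cA: "card A + 1 = N" using card_closed_nbh[OF assms(2)] assms(5) by (simp add: A_def)
  have split: "deficiency N W = deficiency N (W - A) + (\<Sum>v\<in>A. loss v)"
    unfolding loss_def using deficiency_Diff[OF assms(2) AW, of N] by simp
  have lu: "loss u = 1"
  proof -
    have "nbh (W - A) u = {}" by (auto simp: A_def nbh_def)
    then show ?thesis using assms(5) by (simp add: loss_def)
  qed
  have out: "card (nbh W v) \<le> 3 \<and> card (nbh (W - A) v) \<le> 2 \<or> card (nbh (W - A) v) \<le> 1"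
    if "v \<in> A" "v \<noteq> u" for v
  proof -
    have vu: "v \<in> nbh W u" using that by (simp add: A_def)
    show ?thesis using nbh_outside_closed_nbh[OF assms(1,2,4) vu, folded A_def] assms(5)
      by linarith
  qed
  have extend: "\<exists>S\<subseteq>W. card S = N \<and> deficiency N (W - S) \<le> deficiency N W"
    if x: "x \<in> W - A" and le: "2 * int (card (nbh (W - A) x)) \<le> (\<Sum>v\<in>A. loss v) + int N - 1" for x
  proof -
    have "card (insert x A) = N" using x finA cA by simp
    moreover have "W - insert x A = W - A - {x}" by auto
    then have "deficiency N (W - insert x A) \<le> deficiency N W"
      using deficiency_remove1[of "W - A" x N] x le split assms(2) by simp
    ultimately show ?thesis using x AW by (intro exI[of _ "insert x A"]) auto
  qed
  text \<open>
    If some \<open>v\<close> in \<open>A\<close> of degree \<open>N - 2\<close> has an outside neighbour \<open>x\<close>, then the edge \<open>vx\<close>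
    bounds the neighbours of \<open>x\<close> outside \<open>A\<close>, so \<open>A\<close> is extended by \<open>x\<close>. Otherwise every vertex
    of \<open>A\<close> has \<open>loss\<close> at least 1 and \<open>A\<close> can be extended by an arbitrary vertex.
  \<close>
  show ?thesis
  proof (cases "\<exists>v\<in>A. card (nbh W v) + 2 = N \<and> nbh (W - A) v \<noteq> {}")
    case True
    then obtain v x where v: "v \<in> A" "card (nbh W v) + 2 = N" and x: "x \<in> nbh (W - A) v" by blast
    have vn: "v \<noteq> u" using x by (auto simp: nbh_def A_def)
    have xW: "x \<in> W - A" "x \<in> nbh W v" using x by (auto simp: nbh_def)
    have "card (nbh (W - A) v) = 1"
    proof -
      have "card (nbh (W - A) v) \<le> 1" using out[OF v(1) vn] v(2) assms(3) by auto
      moreover have "card (nbh (W - A) v) \<noteq> 0" using x assms(2) by auto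
      ultimately show ?thesis by simp
    qed
    then have sx: "nbh (W - A) v = {x}" using x by (metis card_1_singletonE singletonD)
    have "z = x" if "z \<in> W - A" "adj v z" for z
    proof -
      have "z \<in> nbh (W - A) v" using that by (simp add: nbh_def)
      then show ?thesis unfolding sx by simp
    qed
    \<comment> \<open>All other vertices outside \<open>A\<close> are non-neighbours of
      \<open>v\<close>, so the neighbours of \<open>x\<close> among them lie outside the closed
      neighbourhood of \<open>v\<close>, and the edge \<open>v x\<close> controls them.\<close>
    then have "nbh (W - A) x \<subseteq> nbh (W - insert v (nbh W v)) x"
      using adj_irrefl[of x] v(1) unfolding nbh_def by blast
    then have le: "card (nbh (W - A) x) \<le> card (nbh (W - insert v (nbh W v)) x)"
      using assms(2) by (intro card_mono) auto
    have vW: "v \<in> W" using v(1) AW by blast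
    have "card (nbh (W - A) x) \<le> 2"
      using nbh_outside_closed_nbh[OF assms(1,2) vW xW(2)] v(2) le by linarith
    moreover have "0 \<le> (\<Sum>v\<in>A. loss v)"
    proof (rule sum_nonneg)
      fix w assume w: "w \<in> A"
      show "0 \<le> loss w"
      proof (cases "w = u")
        case True
        then show ?thesis using lu by simp
      next
        case False
        then show ?thesis
          using out[OF w False] deg[OF subsetD[OF AW w]] assms(3) unfolding loss_def by linarith
      qed
    qed
    ultimately show ?thesis using extend[OF xW(1)] assms(3) by simp
  next
    case False
    have "1 \<le> loss w" if w: "w \<in> A" for w
    proof (cases "w = u")
      case True
      then show ?thesis using lu by simp
    next
      case wu: False
      have d: "card (nbh W w) + 2 \<le> N" using deg w AW by auto
      have "card (nbh W w) + 3 \<le> N \<or> card (nbh (W - A) w) = 0"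
        using d False w by force
      then show ?thesis using out[OF w wu] d assms(3) unfolding loss_def by linarith
    qed
    then have s: "int (card A) \<le> (\<Sum>v\<in>A. loss v)"
      using sum_mono[of A "\<lambda>_. 1" loss] by simp
    have "card A < card W" using cA assms(6) by simp
    then obtain x where x: "x \<in> W - A" using AW by (metis Diff_eq_empty_iff card_mono finA leD ex_in_conv)
    have "card (nbh (W - A) x) \<le> card (nbh W x)" using assms(2) by (intro card_nbh_mono) auto
    moreover have "card (nbh W x) + 2 \<le> N" using deg x by blast
    \<comment> \<open>The total loss is at least \<open>N - 1\<close>, so the right side reaches
      \<open>2 * (N - 1)\<close>, more than twice any degree.\<close>
    ultimately have "2 * int (card (nbh (W - A) x)) \<le> (\<Sum>v\<in>A. loss v) + int N - 1"
      using s cA by linarith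
    then show ?thesis by (rule extend[OF x])
  qed
qed

text \<open>The cases follow the maximum degree of \<open>W\<close>, each earlier lemma assuming
  that no larger degree occurs.\<close>

lemma reduction:
  assumes "tree_free N W" "finite W" "N \<ge> 14" "N \<le> card W" "u \<in> W" "N \<le> card (nbh W u) + 2"
  shows "\<exists>S\<subseteq>W. card S = N \<and> deficiency N (W - S) \<le> deficiency N W"
proof (cases "\<exists>v\<in>W. N \<le> card (nbh W v)")
  case True
  then show ?thesis using reduction_large[OF assms(1-3)] by blast
next
  case F1: False
  show ?thesis
  proof (cases "\<exists>v\<in>W. N = card (nbh W v) + 1")
    case True
    then obtain v where v: "v \<in> W" "card (nbh W v) + 1 = N" by auto
    have "card (nbh W w) + 1 \<le> N" if "w \<in> W" for w
      using F1 that by (simp add: not_le Suc_le_eq)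
    then show ?thesis using reduction_N_minus_1[OF assms(1-3) v] by blast
  next
    case False
    have deg: "card (nbh W v) + 2 \<le> N" if "v \<in> W" for v
    proof -
      have "\<not> N \<le> card (nbh W v)" "N \<noteq> card (nbh W v) + 1" using that F1 False by blast+
      then show ?thesis by linarith
    qed
    then have "card (nbh W u) + 2 = N" using assms(5,6) by (meson antisym)
    then show ?thesis using reduction_N_minus_2[OF assms(1-3,5) _ assms(4) deg] by blast
  qed
qed

section \<open>Lower bound on the deficiency\<close>

lemma int_product_bound:
  fixes r N :: int
  assumes "14 \<le> N" "3 \<le> r" "r \<le> N - 8"
  shows "2 * N - 5 \<le> (r + 2) * (N - 5 - r)"
proof -
  \<comment> \<open>The product to be bounded is concave in \<open>r\<close>; this factorisation
    over the ends 3 and \<open>N - 8\<close> of the range leaves a linear remainder.\<close>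
  have "0 \<le> (r - 3) * (N - 8 - r)" using assms by simp
  moreover have "(r + 2) * (N - 5 - r) = (r - 3) * (N - 8 - r) + 3 * r + 5 * N - 5 * r - 34"
    by (simp add: algebra_simps)
  ultimately show ?thesis using assms by linarith
qed

text \<open>Two per vertex gives only \<open>2 * (N + r)\<close> here, so vertices of degree exactly
  \<open>N - 3\<close> need separate treatment.\<close>

lemma deficiency_single_period:
  assumes "tree_free N W" "finite W" "N \<ge> 14" "card W = N + r" "3 \<le> r" "r + 8 \<le> N"
    and deg: "\<And>v. v \<in> W \<Longrightarrow> card (nbh W v) + 3 \<le> N"
  shows "min (int r * (int N - int r)) (3 * (int N + int r)) \<le> deficiency N W"
proof (cases "\<exists>u\<in>W. card (nbh W u) + 3 = N")
  case False
  then have "card (nbh W v) + 4 \<le> N" if "v \<in> W" for v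
    using that deg[OF that] by force
  then have "3 * int (card W) \<le> deficiency N W" by (intro deficiency_ge_mult) force
  then show ?thesis using assms(4) by simp
next
  case True
  then obtain u where u: "u \<in> W" "card (nbh W u) + 3 = N" by blast
  define A where "A = insert u (nbh W u)"
  define loss where "loss v = int N - 1 - int (card (nbh W v)) - int (card (nbh (W - A) v))" for v
  have AW: "A \<subseteq> W" using u(1) nbh_subset by (auto simp: A_def)
  have finA: "finite A" using AW assms(2) finite_subset by blast
  have cA: "card A + 2 = N" using card_closed_nbh[OF assms(2)] u(2) by (simp add: A_def)
  have cWA: "card (W - A) = r + 2" using card_Diff_subset[OF finA AW] cA assms(4) by simp
  have split: "deficiency N W = deficiency N (W - A) + (\<Sum>v\<in>A. loss v)"
    unfolding loss_def using deficiency_Diff[OF assms(2) AW, of N] by simp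
  have lu: "loss u = 2"
  proof -
    have "nbh (W - A) u = {}" by (auto simp: A_def nbh_def)
    then show ?thesis using u(2) by (simp add: loss_def)
  qed
  have out: "card (nbh (W - A) v) \<le> 2" if "v \<in> A" "v \<noteq> u" for v
  proof -
    have vu: "v \<in> nbh W u" using that by (simp add: A_def)
    show ?thesis using nbh_outside_closed_nbh[OF assms(1,2) u(1) vu, folded A_def] u(2)
      by linarith
  qed
  have rest: "(\<Sum>v\<in>A. loss v) = 2 + (\<Sum>v\<in>A - {u}. loss v)"
    using lu finA by (subst sum.remove[of A u]) (auto simp: A_def)
  text \<open>
    If some \<open>v\<close> in \<open>A\<close> of degree \<open>N - 3\<close> has an outside neighbour \<open>x\<close>, then \<open>x\<close> has few
    neighbours outside \<open>A\<close>, and \<open>A\<close> together with \<open>x\<close> and any further vertex can be removed,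
    leaving \<open>r\<close> vertices. Otherwise \<open>loss\<close> is at least 1 on all of \<open>A\<close>.
  \<close>
  show ?thesis
  proof (cases "\<exists>v\<in>A. card (nbh W v) + 3 = N \<and> nbh (W - A) v \<noteq> {}")
    case True
    then obtain v x where v: "v \<in> A" "card (nbh W v) + 3 = N" and x: "x \<in> nbh (W - A) v" by blast
    have vn: "v \<noteq> u" using x by (auto simp: nbh_def A_def)
    have xW: "x \<in> W - A" "x \<in> nbh W v" using x by (auto simp: nbh_def)
    have vW: "v \<in> W" using v AW by blast
    define B where "B = insert v (nbh W v)"
    \<comment> \<open>Unlike before, \<open>v\<close> may have a second neighbour outside
      \<open>A\<close>, which adds at most one to the count for \<open>x\<close>.\<close>
    have "nbh (W - A) x \<subseteq> nbh (W - B) x \<union> (nbh (W - A) v - {x})"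
      using adj_irrefl[of x] v(1) by (auto simp: nbh_def B_def)
    then have "card (nbh (W - A) x) \<le> card (nbh (W - B) x \<union> (nbh (W - A) v - {x}))"
      using assms(2) by (intro card_mono) auto
    also have "\<dots> \<le> card (nbh (W - B) x) + card (nbh (W - A) v - {x})"
      by (rule card_Un_le)
    also have "card (nbh (W - A) v - {x}) \<le> 1"
      using out[OF v(1) vn] x assms(2) by simp
    also have "card (nbh (W - B) x) \<le> 2"
      using nbh_outside_closed_nbh[OF assms(1,2) vW xW(2), folded B_def] v(2) by linarith
    finally have cx: "card (nbh (W - A) x) \<le> 3" by simp
    have "card (W - A - {x}) \<noteq> 0" using cWA xW(1) assms(2) by simp
    then have "W - A - {x} \<noteq> {}" by force
    then obtain y where y: "y \<in> W - A" "y \<noteq> x" by blast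
    have "card (nbh (W - A) y) \<le> card (nbh W y)" using assms(2) by (intro card_nbh_mono) auto
    then have cy: "card (nbh (W - A) y) + 3 \<le> N" using deg[of y] y by auto
    have "0 \<le> (\<Sum>w\<in>A - {u}. loss w)"
    proof (rule sum_nonneg)
      fix w assume "w \<in> A - {u}"
      then have w: "w \<in> A" "w \<noteq> u" by auto
      show "0 \<le> loss w"
        using out[OF w] deg[OF subsetD[OF AW w(1)]] unfolding loss_def by linarith
    qed
    \<comment> \<open>Removing \<open>x\<close> and \<open>y\<close> raises the deficiency by at
      most \<open>6 + 2 * (N - 3) - (2 * N - 2) = 2\<close>, which the loss 2 at \<open>u\<close>
      pays for.\<close>
    then have "deficiency N (W - A - {x, y}) \<le> deficiency N W"
      using deficiency_remove_pair[of "W - A" x y N] xW(1) y cx cy assms(2) split rest by simp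
    moreover have "card (W - A - {x, y}) = r"
      using xW(1) y cWA assms(2) by (subst card_Diff_subset) auto
    ultimately show ?thesis
      using deficiency_ge_clique[of "W - A - {x, y}" N] assms(2) by simp
  next
    case False
    have "1 \<le> loss w" if "w \<in> A - {u}" for w
    proof -
      have w: "w \<in> A" "w \<noteq> u" using that by auto
      have d: "card (nbh W w) + 3 \<le> N" using deg w AW by auto
      have "card (nbh W w) + 4 \<le> N \<or> card (nbh (W - A) w) = 0"
        using d False w by force
      then show ?thesis using out[OF w] d unfolding loss_def by linarith
    qed
    then have s: "int (card (A - {u})) \<le> (\<Sum>v\<in>A - {u}. loss v)"
      using sum_mono[of "A - {u}" "\<lambda>_. 1" loss] by simp
    have "card (A - {u}) + 3 = N" using u(2) adj_irrefl by (simp add: A_def nbh_def)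
    then have "deficiency N (W - A) + int N - 1 \<le> deficiency N W"
      using s split rest by simp
    moreover have "(int r + 2) * (int N - (int r + 2)) \<le> deficiency N (W - A)"
      using deficiency_ge_clique[of "W - A" N] assms(2) unfolding cWA by (simp add: add.commute)
    \<comment> \<open>With \<open>int_product_bound\<close> the total is at least
      \<open>(N - 1) + (2 * N - 5) + 3 * r + 6\<close>, which is exactly
      \<open>3 * (N + r)\<close>.\<close>
    moreover have "(int r + 2) * (int N - (int r + 2)) = (int r + 2) * (int N - 5 - int r) + 3 * int r + 6"
      by (simp add: algebra_simps)
    ultimately show ?thesis
      using int_product_bound[of "int N" "int r"] assms(3,5,6) by simp
  qed
qed

text \<open>Induction on the number of blocks of \<open>N\<close> vertices: either
  \<open>reduction\<close> removes one, or all degrees are at most \<open>N - 3\<close>.\<close>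

lemma deficiency_lower_bound:
  assumes "tree_free N W" "finite W" "N \<ge> 14" "card W = k * N + r" "3 \<le> r" "r + 8 \<le> N"
  shows "min (int r * (int N - int r)) (3 * (int N + int r)) \<le> deficiency N W"
  using assms(1,2,4)
proof (induction k arbitrary: W)
  case 0
  then show ?case using deficiency_ge_clique[of W N] by simp
next
  case (Suc k)
  show ?case
  proof (cases "\<exists>u\<in>W. N \<le> card (nbh W u) + 2")
    case True
    then obtain u where "u \<in> W" "N \<le> card (nbh W u) + 2" by blast
    then obtain S where S: "S \<subseteq> W" "card S = N" "deficiency N (W - S) \<le> deficiency N W"
      using reduction[OF Suc.prems(1,2) assms(3)] Suc.prems(3) by auto
    have "card (W - S) = k * N + r"
      using S Suc.prems by (subst card_Diff_subset) (auto intro: finite_subset)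
    then have "min (int r * (int N - int r)) (3 * (int N + int r)) \<le> deficiency N (W - S)"
      using Suc.IH[of "W - S"] tree_free_mono[OF Suc.prems(1,2)] Suc.prems(2) by auto
    then show ?thesis using S(3) by linarith
  next
    case False
    then have deg: "card (nbh W v) + 3 \<le> N" if "v \<in> W" for v using that by force
    show ?thesis
    proof (cases k)
      case 0
      then show ?thesis
        using deficiency_single_period[OF Suc.prems(1,2) assms(3)] assms(5,6) Suc.prems(3) deg by simp
    next
      case (Suc l)
      have "2 * int (card W) \<le> deficiency N W" by (intro deficiency_ge_mult) (use deg in force)
      \<comment> \<open>At least \<open>2 * N + r\<close> vertices remain, and \<open>r\<close> is
        below \<open>N\<close>.\<close>
      moreover have "3 * (N + r) \<le> 2 * card W"
        using Suc Suc.prems(3) assms(6) by simp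
      then have "3 * (int N + int r) \<le> 2 * int (card W)"
        using of_nat_mono[of "3 * (N + r)" "2 * card W"] by fastforce
      ultimately have "3 * (int N + int r) \<le> deficiency N W" by linarith
      then show ?thesis by simp
    qed
  qed
qed

end

section \<open>From edge sets to adjacency, and embedding the tree\<close>

lemma finite_simple_graph_edges: "simple_graph V E \<Longrightarrow> finite E"
  unfolding simple_graph_def by (rule finite_subset[of E "Pow V"]) auto

lemma simple_graph_adjacency: "simple_graph V E \<Longrightarrow> adjacency (\<lambda>x y. {x, y} \<in> E)"
  by unfold_locales (auto simp: insert_commute simple_graph_def)

lemma handshake:
  assumes "simple_graph V E"
  shows "(\<Sum>v\<in>V. card {w \<in> V. {v, w} \<in> E}) = 2 * card E"
proof -
  have fin: "finite V" "finite E"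
    using assms finite_simple_graph_edges by (auto simp: simple_graph_def)
  have "card {w \<in> V. {v, w} \<in> E} = card {e \<in> E. v \<in> e}" if "v \<in> V" for v
  proof (rule bij_betw_same_card)
    show "bij_betw (\<lambda>w. {v, w}) {w \<in> V. {v, w} \<in> E} {e \<in> E. v \<in> e}"
    proof (rule bij_betw_imageI)
      show "inj_on (\<lambda>w. {v, w}) {w \<in> V. {v, w} \<in> E}"
        by (auto simp: inj_on_def doubleton_eq_iff)
      show "(\<lambda>w. {v, w}) ` {w \<in> V. {v, w} \<in> E} = {e \<in> E. v \<in> e}"
      proof (intro equalityI subsetI)
        fix e assume e: "e \<in> {e \<in> E. v \<in> e}"
        then have "card e = 2" "e \<subseteq> V" using assms by (auto simp: simple_graph_def)
        then obtain a b where "e = {a, b}" by (auto simp: card_2_iff)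
        then show "e \<in> (\<lambda>w. {v, w}) ` {w \<in> V. {v, w} \<in> E}"
          using e \<open>e \<subseteq> V\<close> by (auto simp: insert_commute)
      qed auto
    qed
  qed
  then have "(\<Sum>v\<in>V. card {w \<in> V. {v, w} \<in> E}) = (\<Sum>v\<in>V. card {e \<in> E. v \<in> e})"
    by simp
  also have "\<dots> = 2 * card E"
  proof (rule sum_multicount[OF fin])
    show "\<forall>e\<in>E. card {v \<in> V. v \<in> e} = 2"
    proof
      fix e assume "e \<in> E"
      then have "e \<subseteq> V" "card e = 2" using assms by (auto simp: simple_graph_def)
      moreover have "{v \<in> V. v \<in> e} = e" using \<open>e \<subseteq> V\<close> by auto
      ultimately show "card {v \<in> V. v \<in> e} = 2" by simp
    qed
  qed
  finally show ?thesis .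
qed

lemma T3_edgesE:
  assumes "e \<in> T3_edges n" "n \<ge> 6"
  obtains i where "1 \<le> i" "i \<le> n - 4" "e = {0, i}" | i where "n - 3 \<le> i" "i < n" "e = {1, i}"
proof -
  from assms(1) consider i where "1 \<le> i" "i \<le> n - 4" "e = {0, i}"
    | "e = {1, n - 3}" | "e = {1, n - 2}" | "e = {1, n - 1}"
    unfolding T3_edges_def by blast
  then show thesis
  proof cases
    case 1
    then show thesis by (rule that(1))
  next
    case 2
    then show thesis using that(2)[of "n - 3"] assms(2) by simp
  next
    case 3
    then show thesis using that(2)[of "n - 2"] assms(2) by simp
  next
    case 4
    then show thesis using that(2)[of "n - 1"] assms(2) by simp
  qed
qed

text \<open>The centres 0 and 1 go to \<open>u\<close> and \<open>v\<close>, the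
  \<open>n - 5\<close> leaves at 0 to \<open>A\<close> and the three leaves at 1 to
  \<open>B\<close>.\<close>

lemma contains_T3I:
  assumes "simple_graph V E" "n \<ge> 6" "{u, v} \<in> E"
    and A: "A \<subseteq> {w. {u, w} \<in> E} - {v}" "card A = n - 5"
    and B: "B \<subseteq> {w. {v, w} \<in> E} - {u}" "card B = 3"
    and "A \<inter> B = {}"
  shows "contains_copy V E (T3_vertices n) (T3_edges n)"
proof -
  have edge: "x \<in> V \<and> y \<in> V \<and> x \<noteq> y" if "{x, y} \<in> E" for x y
  proof -
    have "{x, y} \<subseteq> V" "card {x, y} = 2" using assms(1) that unfolding simple_graph_def by blast+
    then show ?thesis by (auto simp: card_insert_if split: if_splits)
  qed
  have "finite V" using assms(1) by (simp add: simple_graph_def)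
  have AV: "A \<subseteq> V" "B \<subseteq> V" using A(1) B(1) edge by blast+
  then have fin: "finite A" "finite B" using \<open>finite V\<close> finite_subset by auto
  obtain g where g: "bij_betw g {2..n - 4} A"
    using finite_same_card_bij[of "{2..n - 4}" A] fin A(2) assms(2) by auto
  obtain h where h: "bij_betw h {n - 3..<n} B"
    using finite_same_card_bij[of "{n - 3..<n}" B] fin B(2) assms(2) by auto
  define f where "f i = (if i = 0 then u else if i = 1 then v else if i \<le> n - 4 then g i else h i)" for i
  have dom: "{0..<n} = {0, 1} \<union> {2..n - 4} \<union> {n - 3..<n}" using assms(2) by auto
  have "f ` {0, 1} = {u, v}" by (auto simp: f_def)
  moreover have "f ` {2..n - 4} = A"
    using g by (auto simp: f_def bij_betw_def)
  moreover have "f ` {n - 3..<n} = h ` {n - 3..<n}"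
    using assms(2) by (intro image_cong) (auto simp: f_def)
  then have "f ` {n - 3..<n} = B" using h by (auto simp: bij_betw_def)
  ultimately have img: "f ` {0..<n} = {u, v} \<union> A \<union> B" 
    unfolding dom image_Un by simp
  have uv: "u \<noteq> v" "u \<notin> A" "v \<notin> A" "u \<notin> B" "v \<notin> B"
    using edge assms(3) A(1) B(1) by blast+
  have "card ({u, v} \<union> A \<union> B) = n"
    using uv fin assms(2,8) A(2) B(2) by (simp add: card_Un_disjoint)
  \<comment> \<open>Injectivity by counting: the image has as many elements as the domain.\<close>
  then have "inj_on f {0..<n}"
    by (intro eq_card_imp_inj_on) (auto simp: img)
  moreover have "f ` {0..<n} \<subseteq> V"
    unfolding img using AV edge[OF assms(3)] by auto
  moreover have "f ` e \<in> E" if e: "e \<in> T3_edges n" for e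
  proof -
    have f01: "f 0 = u" "f 1 = v" by (simp_all add: f_def)
    have fA: "f i \<in> A" if "2 \<le> i" "i \<le> n - 4" for i
      using that \<open>f ` {2..n - 4} = A\<close> by auto
    have fB: "f i \<in> B" if "n - 3 \<le> i" "i < n" for i
      using that \<open>f ` {n - 3..<n} = B\<close> by auto
    consider i where "1 \<le> i" "i \<le> n - 4" "e = {0, i}" | i where "n - 3 \<le> i" "i < n" "e = {1, i}"
      using T3_edgesE[OF e] assms(2) by metis
    then show ?thesis
    proof cases
      case 1
      have "{u, f i} \<in> E"
      proof (cases "i = 1")
        case True
        then show ?thesis using assms(3) f01 by simp
      next
        case False
        then show ?thesis using 1 fA[of i] A(1) by auto
      qed
      then show ?thesis using 1 f01 by simp
    next
      case 2
      have "{v, f i} \<in> E" using 2 fB[of i] B(1) by auto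
      then show ?thesis using 2 f01 by simp
    qed
  qed
  ultimately show ?thesis unfolding contains_copy_def T3_vertices_def by blast
qed

lemma tree_free_if_no_T3:
  assumes "simple_graph V E" "N \<ge> 5"
    and "\<not> contains_copy V E (T3_vertices (N + 1)) (T3_edges (N + 1))"
  shows "adjacency.tree_free (\<lambda>x y. {x, y} \<in> E) N V"
proof -
  interpret adjacency "\<lambda>x y. {x, y} \<in> E" by (rule simple_graph_adjacency[OF assms(1)])
  have fin: "finite V" using assms(1) by (simp add: simple_graph_def)
  show ?thesis
    unfolding tree_free_def
  proof (intro ballI impI, rule ccontr)
    fix u v
    assume uv: "u \<in> V" "v \<in> V" "{u, v} \<in> E" and du: "N \<le> card (nbh V u) + 3"
      and dv: "4 \<le> card (nbh V v)" and un: "\<not> card (nbh V u \<union> nbh V v) \<le> N"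
    \<comment> \<open>These neighbours of \<open>v\<close> can serve as its leaves without competing
      with \<open>u\<close>.\<close>
    define X where "X = nbh V v - {u} - nbh V u"
    have memb: "v \<in> nbh V u" "u \<in> nbh V v" "u \<notin> nbh V u"
      using uv adj_irrefl by (auto simp: nbh_def insert_commute)
    have finX: "finite X" using fin by (simp add: X_def)
    have Xu: "N < card (nbh V u) + 1 + card X"
    proof -
      have "nbh V u \<union> nbh V v = insert u (nbh V u \<union> X)" using memb by (auto simp: X_def)
      moreover have "card (nbh V u \<union> X) = card (nbh V u) + card X"
        using fin finX by (intro card_Un_disjoint) (auto simp: X_def)
      then have "card (insert u (nbh V u \<union> X)) = card (nbh V u) + card X + 1"
        using memb fin finX by (subst card_insert_disjoint) (auto simp: X_def)
      ultimately show ?thesis using un by simp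
    qed
    \<comment> \<open>The leaves of \<open>v\<close> are taken from \<open>X\<close> as far as
      possible, so that few neighbours of \<open>u\<close> are used up.\<close>
    obtain B where B: "B \<subseteq> nbh V v - {u}" "card B = 3" "card (B - X) \<le> 3 - card X"
    proof (cases "3 \<le> card X")
      case True
      then obtain B where "B \<subseteq> X" "card B = 3" using obtain_subset_with_card_n by metis
      moreover from this have "B \<subseteq> nbh V v - {u}" by (auto simp: X_def)
      moreover have "card (B - X) = 0" using \<open>B \<subseteq> X\<close> by (metis Diff_eq_empty_iff card.empty)
      ultimately show ?thesis by (intro that[of B]) simp_all
    next
      case False
      have "card (nbh V v - {u} - X) = card (nbh V v) - 1 - card X"
        using fin finX memb by (subst card_Diff_subset) (auto simp: X_def)
      then have "3 - card X \<le> card (nbh V v - {u} - X)" using dv by simp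
      then obtain C where C: "C \<subseteq> nbh V v - {u} - X" "card C = 3 - card X" "finite C"
        using obtain_subset_with_card_n by metis
      have "card (X \<union> C) = 3"
        using C False finX by (subst card_Un_disjoint) auto
      moreover have "X \<union> C - X = C" using C by auto
      ultimately show ?thesis using that[of "X \<union> C"] C by (auto simp: X_def)
    qed
    have finB: "finite B" using B(2) card.infinite by fastforce
    have "card (nbh V u - {v}) - card (B - X) \<le> card (nbh V u - {v} - (B - X))"
      by (rule diff_card_le_card_Diff) (use finB in simp)
    moreover have "card (nbh V u - {v}) = card (nbh V u) - 1" using memb fin by simp
    \<comment> \<open>If \<open>X\<close> has three elements, the degree of \<open>u\<close>
      suffices; otherwise \<open>Xu\<close> makes up for the at most \<open>3 - card X\<close>
      neighbours taken.\<close>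
    ultimately have "N - 4 \<le> card (nbh V u - {v} - (B - X))"
      using B(3) Xu du by linarith
    then obtain A where A: "A \<subseteq> nbh V u - {v} - (B - X)" "card A = N - 4"
      using obtain_subset_with_card_n by metis
    have "A \<inter> B = {}" using A(1) by (auto simp: X_def)
    then have "contains_copy V E (T3_vertices (N + 1)) (T3_edges (N + 1))"
      using A B assms(2) uv by (intro contains_T3I[OF assms(1), of "N + 1" u v A B]) (auto simp: nbh_def)
    then show False using assms(3) by simp
  qed
qed

text \<open>By \<open>handshake\<close> the deficiency is \<open>(N - 1) * card V\<close> minus
  twice the number of edges.\<close>

lemma card_edges_T3_free_le:
  assumes "simple_graph V E" "N \<ge> 14" "card V = k * N + r" "3 \<le> r" "r + 8 \<le> N"
    and "\<not> contains_copy V E (T3_vertices (N + 1)) (T3_edges (N + 1))"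
  shows "2 * int (card E) \<le> (int N - 1) * int (card V)
    - min (int r * (int N - int r)) (3 * (int N + int r))"
proof -
  interpret adjacency "\<lambda>x y. {x, y} \<in> E" by (rule simple_graph_adjacency[OF assms(1)])
  have fin: "finite V" using assms(1) by (simp add: simple_graph_def)
  have "int (\<Sum>v\<in>V. card (nbh V v)) = int (2 * card E)"
    using handshake[OF assms(1)] by (simp add: nbh_def)
  then have "deficiency N V = (int N - 1) * int (card V) - 2 * int (card E)"
    by (simp add: deficiency_def sum_subtractf left_diff_distrib mult.commute)
  moreover have "tree_free N V" by (rule tree_free_if_no_T3) (use assms in auto)
  ultimately show ?thesis
    using deficiency_lower_bound[OF _ fin assms(2-5)] by simp
qed

section \<open>Criteria for containing no copy of the tree\<close>

lemma no_copy_small: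
  assumes "finite V" "card V < n"
  shows "\<not> contains_copy V E (T3_vertices n) EL"
proof
  assume "contains_copy V E (T3_vertices n) EL"
  then obtain f where "inj_on f {0..<n}" "f ` {0..<n} \<subseteq> V"
    by (auto simp: contains_copy_def T3_vertices_def)
  then have "n \<le> card V" using card_inj_on_le[of f "{0..<n}" V] assms(1) by simp
  then show False using assms(2) by simp
qed

text \<open>The image of the centre 0 would need \<open>n - 4\<close> neighbours.\<close>

lemma no_copy_small_degree:
  assumes "simple_graph V E" "n \<ge> 6" "\<And>v. v \<in> V \<Longrightarrow> card {w \<in> V. {v, w} \<in> E} < n - 4"
  shows "\<not> contains_copy V E (T3_vertices n) (T3_edges n)"
proof
  assume "contains_copy V E (T3_vertices n) (T3_edges n)"
  then obtain f where f: "inj_on f {0..<n}" "f ` {0..<n} \<subseteq> V" "\<And>e. e \<in> T3_edges n \<Longrightarrow> f ` e \<in> E"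
    by (auto simp: contains_copy_def T3_vertices_def)
  have "f ` {1..n - 4} \<subseteq> {w \<in> V. {f 0, w} \<in> E}"
  proof
    fix w assume "w \<in> f ` {1..n - 4}"
    then obtain i where i: "1 \<le> i" "i \<le> n - 4" "w = f i" by auto
    then have "{0, i} \<in> T3_edges n" by (auto simp: T3_edges_def)
    then have "f ` {0, i} \<in> E" by (rule f(3))
    moreover have "f i \<in> V" using f(2) i assms(2) by auto
    ultimately show "w \<in> {w \<in> V. {f 0, w} \<in> E}" using i by simp
  qed
  moreover have "inj_on f {1..n - 4}" using f(1) assms(2) by (rule_tac inj_on_subset) auto
  ultimately have "card {1..n - 4} \<le> card {w \<in> V. {f 0, w} \<in> E}"
    using assms(1) by (intro card_inj_on_le) (auto simp: simple_graph_def)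
  moreover have "f 0 \<in> f ` {0..<n}" using assms(2) by simp
  then have "f 0 \<in> V" using f(2) by blast
  ultimately show False using assms(3)[of "f 0"] by simp
qed

text \<open>Connectedness of the tree: membership in \<open>V1\<close> spreads along edges from 0 to
  1 and on to all leaves.\<close>

lemma copy_in_part:
  assumes "simple_graph V1 E1" "simple_graph V2 E2" "V1 \<inter> V2 = {}" "n \<ge> 6"
    and f: "inj_on f {0..<n}" "\<And>e. e \<in> T3_edges n \<Longrightarrow> f ` e \<in> E1 \<union> E2" "f 0 \<in> V1"
  shows "contains_copy V1 E1 (T3_vertices n) (T3_edges n)"
proof -
  have step: "f b \<in> V1 \<and> f ` {a, b} \<in> E1" if "{a, b} \<in> T3_edges n" "f a \<in> V1" for a b
  proof -
    have "f ` {a, b} \<notin> E2"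
    proof
      assume "f ` {a, b} \<in> E2"
      then have "f ` {a, b} \<subseteq> V2" using assms(2) by (auto simp: simple_graph_def)
      then show False using assms(3) that(2) by auto
    qed
    then have e: "f ` {a, b} \<in> E1" using f(2)[OF that(1)] by blast
    then have "f ` {a, b} \<subseteq> V1" using assms(1) by (auto simp: simple_graph_def)
    then show ?thesis using e by simp
  qed
  have e0: "{0, i} \<in> T3_edges n" if "1 \<le> i" "i \<le> n - 4" for i
    using that by (auto simp: T3_edges_def)
  have e1: "{1, i} \<in> T3_edges n" if "n - 3 \<le> i" "i < n" for i
  proof -
    have "i = n - 3 \<or> i = n - 2 \<or> i = n - 1" using that by linarith
    then show ?thesis by (auto simp: T3_edges_def)
  qed
  have f1: "f 1 \<in> V1" using step[OF e0[of 1] f(3)] assms(4) by simp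
  have "f i \<in> V1" if "i < n" for i
  proof -
    consider "i = 0" | "1 \<le> i" "i \<le> n - 4" | "n - 3 \<le> i" using that by linarith
    then show ?thesis
      using step[OF e0 f(3)] step[OF e1 f1] f(3) that by cases auto
  qed
  moreover have "f ` e \<in> E1" if e: "e \<in> T3_edges n" for e
  proof -
    consider i where "1 \<le> i" "i \<le> n - 4" "e = {0, i}" | i where "n - 3 \<le> i" "i < n" "e = {1, i}"
      using T3_edgesE[OF e] assms(4) by metis
    then show ?thesis
      using step[OF e0 f(3)] step[OF e1 f1] by cases auto
  qed
  ultimately show ?thesis
    using f(1) unfolding contains_copy_def T3_vertices_def by (intro exI[of _ f]) auto
qed

lemma no_copy_disjoint_Un:
  assumes "simple_graph V1 E1" "simple_graph V2 E2" "V1 \<inter> V2 = {}" "n \<ge> 6"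
    and "\<not> contains_copy V1 E1 (T3_vertices n) (T3_edges n)"
    and "\<not> contains_copy V2 E2 (T3_vertices n) (T3_edges n)"
  shows "\<not> contains_copy (V1 \<union> V2) (E1 \<union> E2) (T3_vertices n) (T3_edges n)"
proof
  assume "contains_copy (V1 \<union> V2) (E1 \<union> E2) (T3_vertices n) (T3_edges n)"
  then obtain f where f: "inj_on f {0..<n}" "f ` {0..<n} \<subseteq> V1 \<union> V2"
    "\<And>e. e \<in> T3_edges n \<Longrightarrow> f ` e \<in> E1 \<union> E2"
    by (auto simp: contains_copy_def T3_vertices_def)
  have "f 0 \<in> f ` {0..<n}" using assms(4) by simp
  then have "f 0 \<in> V1 \<union> V2" using f(2) by blast
  then show False
  proof
    assume "f 0 \<in> V1"
    then show False using copy_in_part[OF assms(1-4) f(1) f(3)] assms(5) by blast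
  next
    assume f0: "f 0 \<in> V2"
    have "\<And>e. e \<in> T3_edges n \<Longrightarrow> f ` e \<in> E2 \<union> E1" using f(3) by blast
    then show False using copy_in_part[OF assms(2,1) _ assms(4) f(1) _ f0] assms(3,6) by blast
  qed
qed

section \<open>Constructions: added cliques and nearly regular graphs\<close>

lemma simple_graph_clique: "finite V \<Longrightarrow> simple_graph V {e. e \<subseteq> V \<and> card e = 2}"
  by (simp add: simple_graph_def)

text \<open>A clique on \<open>N\<close> vertices is too small for the tree. Each new one occupies
  the next interval, which keeps the vertex set an initial segment.\<close>

lemma add_cliques:
  assumes "simple_graph {0..<m} F" "N \<ge> 5"
    and "\<not> contains_copy {0..<m} F (T3_vertices (N + 1)) (T3_edges (N + 1))"
  shows "\<exists>E. simple_graph {0..<k * N + m} E \<and>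
    \<not> contains_copy {0..<k * N + m} E (T3_vertices (N + 1)) (T3_edges (N + 1)) \<and>
    card E = k * (N choose 2) + card F"
proof (induction k)
  case 0
  then show ?case using assms by auto
next
  case (Suc k)
  define V1 where "V1 = {0..<k * N + m}"
  define V2 where "V2 = {k * N + m..<Suc k * N + m}"
  define K where "K = {e. e \<subseteq> V2 \<and> card e = 2}"
  from Suc obtain E where E: "simple_graph V1 E"
    "\<not> contains_copy V1 E (T3_vertices (N + 1)) (T3_edges (N + 1))"
    "card E = k * (N choose 2) + card F"
    by (auto simp: V1_def)
  have V: "{0..<Suc k * N + m} = V1 \<union> V2" "V1 \<inter> V2 = {}" "finite V2" "card V2 = N"
    by (auto simp: V1_def V2_def)
  have K: "simple_graph V2 K" unfolding K_def by (rule simple_graph_clique[OF V(3)])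
  have cK: "card K = N choose 2" unfolding K_def using n_subsets[OF V(3), of 2] V(4) by simp
  have "simple_graph (V1 \<union> V2) (E \<union> K)"
    using E(1) K by (fastforce simp: simple_graph_def)
  moreover have "\<not> contains_copy (V1 \<union> V2) (E \<union> K) (T3_vertices (N + 1)) (T3_edges (N + 1))"
    using V(3,4) assms(2) by (intro no_copy_disjoint_Un[OF E(1) K V(2) _ E(2)] no_copy_small) auto
  moreover have "E \<inter> K = {}"
  proof (rule ccontr)
    assume "E \<inter> K \<noteq> {}"
    then obtain e where "e \<subseteq> V1" "e \<subseteq> V2" "card e = 2"
      using E(1) by (auto simp: simple_graph_def K_def)
    moreover from this have "e = {}" using V(2) by blast
    ultimately show False by simp
  qed
  then have "card (E \<union> K) = Suc k * (N choose 2) + card F"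
    using E(3) cK finite_simple_graph_edges[OF E(1)] finite_simple_graph_edges[OF K]
    by (simp add: card_Un_disjoint)
  ultimately show ?case unfolding V(1) by blast
qed

text \<open>Vertex \<open>a\<close> is joined to \<open>a + 1, ..., a + e\<close> modulo
  \<open>m\<close>; as \<open>2 * e < m\<close>, no edge arises twice. The last claim bounds cyclic
  distance and keeps a matching of long chords disjoint from \<open>C\<close>.\<close>

lemma circulant_graph:
  fixes m e :: nat
  assumes "2 * e < m"
  defines "C \<equiv> (\<lambda>(a, i). {a, if a + i < m then a + i else a + i - m}) ` ({0..<m} \<times> {1..e})"
  shows "simple_graph {0..<m} C" "card C = e * m"
    "\<And>v. v < m \<Longrightarrow> card {w \<in> {0..<m}. {v, w} \<in> C} \<le> 2 * e"
    "\<And>a b. {a, b} \<in> C \<Longrightarrow> a < b \<Longrightarrow> b \<le> a + e \<or> a + m \<le> b + e"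
proof -
  show "simple_graph {0..<m} C"
    using assms(1) by (auto simp: simple_graph_def C_def card_insert_if split: if_splits)
  have "inj_on (\<lambda>(a, i). {a, if a + i < m then a + i else a + i - m}) ({0..<m} \<times> {1..e})"
    using assms(1) by (auto simp: inj_on_def doubleton_eq_iff split: if_splits)
  then show "card C = e * m" unfolding C_def by (subst card_image) (auto simp: mult.commute)
  show "card {w \<in> {0..<m}. {v, w} \<in> C} \<le> 2 * e" if "v < m" for v
  proof -
    define g where "g i = (if v + i < m then v + i else v + i - m)" for i
    define h where "h i = (if i \<le> v then v - i else v + m - i)" for i
    have "w \<in> g ` {1..e} \<union> h ` {1..e}" if w: "{v, w} \<in> C" for w
    proof -
      from w obtain a i where ai: "a < m" "1 \<le> i" "i \<le> e"
        "{v, w} = {a, if a + i < m then a + i else a + i - m}"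
        by (auto simp: C_def)
      then consider "v = a" "w = g i" | "w = a" "v = (if a + i < m then a + i else a + i - m)"
        unfolding doubleton_eq_iff g_def by blast
      then show ?thesis
      proof cases
        case 1
        then show ?thesis using ai by auto
      next
        case 2
        then have "w = h i" using ai assms(1) by (auto simp: h_def split: if_splits)
        then show ?thesis using ai by auto
      qed
    qed
    then have "card {w \<in> {0..<m}. {v, w} \<in> C} \<le> card (g ` {1..e} \<union> h ` {1..e})"
      by (intro card_mono) auto
    also have "\<dots> \<le> card (g ` {1..e}) + card (h ` {1..e})" by (rule card_Un_le)
    also have "\<dots> \<le> e + e" 
      by (intro add_mono) (metis card_atLeastAtMost card_image_le diff_Suc_1 finite_atLeastAtMost)+
    finally show ?thesis by simp
  qed
  show "b \<le> a + e \<or> a + m \<le> b + e" if "{a, b} \<in> C" "a < b" for a b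
    using that by (auto simp: C_def doubleton_eq_iff split: if_splits)
qed

lemma near_regular_graph:
  fixes m d :: nat
  assumes "d < m"
  shows "\<exists>E. simple_graph {0..<m} E \<and> card E = d * m div 2 \<and>
    (\<forall>v<m. card {w \<in> {0..<m}. {v, w} \<in> E} \<le> d)"
proof -
  define e where "e = d div 2"
  have "2 * e < m" using assms by (simp add: e_def)
  note C = circulant_graph[OF this]
  define C where "C = (\<lambda>(a, i). {a, if a + i < m then a + i else a + i - m}) ` ({0..<m} \<times> {1..e})"
  note C = C[folded C_def]
  show ?thesis
  proof (cases "even d")
    case True
    then have "d = 2 * e" by (simp add: e_def)
    then show ?thesis using C(1-3) by (intro exI[of _ C]) auto
  next
    case False
    then have d: "d = 2 * e + 1" by (simp add: e_def)
    \<comment> \<open>For odd \<open>d\<close>, the chords of length \<open>h\<close> form a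
      matching. If \<open>m\<close> is odd, one vertex stays unmatched, which accounts for the
      rounding in \<open>d * m div 2\<close>.\<close>
    define h where "h = m div 2"
    have h: "e < h" "2 * h \<le> m" using d assms by (auto simp: h_def)
    define M where "M = (\<lambda>a. {a, a + h}) ` {0..<h}"
    have "inj_on (\<lambda>a. {a, a + h}) {0..<h}"
      by (auto simp: inj_on_def doubleton_eq_iff)
    then have cM: "card M = h" unfolding M_def by (subst card_image) auto
    have "C \<inter> M = {}"
    proof (rule ccontr)
      assume "C \<inter> M \<noteq> {}"
      then obtain a where "{a, a + h} \<in> C" "a < h" by (auto simp: M_def)
      then show False using C(4)[of a "a + h"] h by auto
    qed
    then have "card (C \<union> M) = e * m + h"
      using C(2) cM finite_simple_graph_edges[OF C(1)] by (simp add: card_Un_disjoint M_def)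
    moreover have "d * m div 2 = e * m + h"
      unfolding d h_def by (simp add: algebra_simps)
    moreover have "simple_graph {0..<m} (C \<union> M)"
      using C(1) h by (auto simp: simple_graph_def M_def)
    moreover have "card {w \<in> {0..<m}. {v, w} \<in> C \<union> M} \<le> d" if "v < m" for v
    proof -
      \<comment> \<open>For an unmatched \<open>v\<close> the inserted element is no partner, which
        is harmless for an upper bound.\<close>
      have "{w \<in> {0..<m}. {v, w} \<in> C \<union> M} \<subseteq>
          insert (if v < h then v + h else v - h) {w \<in> {0..<m}. {v, w} \<in> C}"
        by (auto simp: M_def doubleton_eq_iff)
      then have "card {w \<in> {0..<m}. {v, w} \<in> C \<union> M} \<le>
          card (insert (if v < h then v + h else v - h) {w \<in> {0..<m}. {v, w} \<in> C})"
        by (intro card_mono) auto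
      also have "\<dots> \<le> Suc (card {w \<in> {0..<m}. {v, w} \<in> C})" by (rule card_insert_le_m1) auto
      finally show ?thesis using C(3)[OF that] d by simp
    qed
    ultimately show ?thesis by (intro exI[of _ "C \<union> M"]) auto
  qed
qed

section \<open>Evaluation of the extremal number\<close>

lemma ex_eqI:
  assumes "simple_graph {0..<p} E" "\<not> contains_copy {0..<p} E VL EL" "card E = b"
    and "\<And>E. simple_graph {0..<p} E \<Longrightarrow> \<not> contains_copy {0..<p} E VL EL \<Longrightarrow> card E \<le> b"
  shows "ex p VL EL = b"
  unfolding ex_def
proof (rule Max_eqI)
  have "{card E |E. simple_graph {0..<p} E \<and> \<not> contains_copy {0..<p} E VL EL}
      \<subseteq> card ` Pow (Pow {0..<p})"
    by (auto simp: simple_graph_def)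
  then show "finite {card E |E. simple_graph {0..<p} E \<and> \<not> contains_copy {0..<p} E VL EL}"
    by (rule finite_subset) simp
qed (use assms in auto)

lemma two_mult_choose_two: "2 * int (n choose 2) = int n * (int n - 1)"
proof -
  have "2 * (n choose 2) = n * (n - 1)" by (cases n) (simp_all add: choose_two)
  then have "2 * int (n choose 2) = int (n * (n - 1))" by (metis of_nat_mult of_nat_numeral)
  then show ?thesis by (cases n) (simp_all add: algebra_simps)
qed

text \<open>Twice the edge counts of the two constructions, written as \<open>(N - 1) * p\<close>
  minus deficiency. The second ignores parity.\<close>

lemma clique_edge_counts:
  fixes k N r :: nat
  shows "2 * int (Suc k * (N choose 2) + (r choose 2)) =
      (int N - 1) * int (Suc k * N + r) - int r * (int N - int r)"
    and "2 * int (k * (N choose 2)) + (int N - 4) * (int N + int r) =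
      (int N - 1) * int (Suc k * N + r) - 3 * (int N + int r)"
proof -
  have "2 * int (Suc k * (N choose 2) + (r choose 2)) =
      int (Suc k) * (2 * int (N choose 2)) + 2 * int (r choose 2)"
    by (simp add: algebra_simps)
  then show "2 * int (Suc k * (N choose 2) + (r choose 2)) =
      (int N - 1) * int (Suc k * N + r) - int r * (int N - int r)"
    unfolding two_mult_choose_two by (simp add: algebra_simps)
  have "2 * int (k * (N choose 2)) = int k * (2 * int (N choose 2))"
    by simp
  then show "2 * int (k * (N choose 2)) + (int N - 4) * (int N + int r) =
      (int N - 1) * int (Suc k * N + r) - 3 * (int N + int r)"
    unfolding two_mult_choose_two by (simp add: algebra_simps)
qed

lemma ex_T3_eq_max:
  assumes "N \<ge> 14" "3 \<le> r" "r + 8 \<le> N"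
  shows "ex (Suc k * N + r) (T3_vertices (N + 1)) (T3_edges (N + 1)) =
    max (Suc k * (N choose 2) + (r choose 2)) (k * (N choose 2) + (N - 4) * (N + r) div 2)"
    (is "ex ?p ?V ?T = max ?e1 ?e2")
proof -
  note d1 = clique_edge_counts(1)[of k N r]
  have "2 * int ((N - 4) * (N + r) div 2) + int ((N - 4) * (N + r) mod 2) = int ((N - 4) * (N + r))"
    by (metis mult_div_mod_eq of_nat_add of_nat_mult of_nat_numeral)
  also have "\<dots> = (int N - 4) * (int N + int r)" using assms(1) by (simp add: of_nat_diff)
  finally have m: "2 * int ((N - 4) * (N + r) div 2) + int ((N - 4) * (N + r) mod 2) =
    (int N - 4) * (int N + int r)" .
  have "2 * int ?e2 + int ((N - 4) * (N + r) mod 2) = 2 * int (k * (N choose 2)) +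
      (2 * int ((N - 4) * (N + r) div 2) + int ((N - 4) * (N + r) mod 2))"
    by (simp only: of_nat_add distrib_left add.assoc)
  also have "\<dots> = (int N - 1) * int ?p - 3 * (int N + int r)"
    unfolding m by (rule clique_edge_counts(2))
  finally have d2: "2 * int ?e2 + int ((N - 4) * (N + r) mod 2)
      = (int N - 1) * int ?p - 3 * (int N + int r)" .
  have "\<exists>E. simple_graph {0..<?p} E \<and> \<not> contains_copy {0..<?p} E ?V ?T \<and> card E = ?e1"
  proof -
    have "\<not> contains_copy {0..<r} {e. e \<subseteq> {0..<r} \<and> card e = 2} ?V ?T"
      using assms by (intro no_copy_small) auto
    moreover have "card {e. e \<subseteq> {0..<r} \<and> card e = 2} = r choose 2"
      using n_subsets[of "{0..<r}" 2] by simp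
    ultimately show ?thesis
      using add_cliques[OF simple_graph_clique[of "{0..<r}"], of N "Suc k"] assms(1) by simp
  qed
  moreover have "\<exists>E. simple_graph {0..<?p} E \<and> \<not> contains_copy {0..<?p} E ?V ?T \<and> card E = ?e2"
  proof -
    have "N - 4 < N + r" using assms(1) by linarith
    then obtain H where H: "simple_graph {0..<N + r} H" "card H = (N - 4) * (N + r) div 2"
      "\<forall>v<N + r. card {w \<in> {0..<N + r}. {v, w} \<in> H} \<le> N - 4"
      using near_regular_graph by blast
    have "\<not> contains_copy {0..<N + r} H ?V ?T"
    proof (rule no_copy_small_degree[OF H(1)])
      fix v assume "v \<in> {0..<N + r}"
      then have "card {w \<in> {0..<N + r}. {v, w} \<in> H} \<le> N - 4" using H(3) by simp
      then show "card {w \<in> {0..<N + r}. {v, w} \<in> H} < N + 1 - 4" using assms(1) by linarith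
    qed (use assms(1) in simp)
    then show ?thesis
      using add_cliques[OF H(1), of N k] H(2) assms(1) by (simp add: ac_simps)
  qed
  moreover have "card E \<le> max ?e1 ?e2"
    if E: "simple_graph {0..<?p} E" "\<not> contains_copy {0..<?p} E ?V ?T" for E
  proof -
    have "2 * int (card E) \<le> (int N - 1) * int ?p
        - min (int r * (int N - int r)) (3 * (int N + int r))"
      using card_edges_T3_free_le[OF E(1) assms(1) _ assms(2,3) E(2), of "Suc k"] by simp
    then consider "2 * int (card E) \<le> 2 * int ?e1"
      | "2 * int (card E) \<le> 2 * int ?e2 + int ((N - 4) * (N + r) mod 2)"
      unfolding d1 d2 by (cases "int r * (int N - int r) \<le> 3 * (int N + int r)") (auto simp: min_def)
    then show ?thesis
    proof cases
      case 2
      \<comment> \<open>Both sides are integers, so the parity term, at most 1, disappears on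
        halving.\<close>
      have half: "a \<le> b" if "2 * a \<le> 2 * b + c" "c \<le> 1" for a b c :: int
        using that by linarith
      have "int (card E) \<le> int ?e2" by (rule half[OF 2]) auto
      then have "card E \<le> ?e2" by (simp only: of_nat_le_iff)
      then show ?thesis by (rule max.coboundedI2)
    next
      case 1
      then have "int (card E) \<le> int ?e1" by (rule mult_left_le_imp_le) simp
      then have "card E \<le> ?e1" by (simp only: of_nat_le_iff)
      then show ?thesis by (rule max.coboundedI1)
    qed
  qed
  ultimately show ?thesis using ex_eqI by (metis (no_types, lifting) max_def)
qed

theorem theorem4p2:
  fixes p n k r :: nat
  assumes "n \<ge> 15" and "p \<ge> n" and "k \<ge> 1"
    and "3 \<le> r" and "r \<le> n - 9"
    and "p = k * (n - 1) + r"
  shows "real (ex p (T3_vertices n) (T3_edges n)) =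
           ((real n - 2) * real p - real r * (real n - 1 - real r)) / 2
           + max 0 (real_of_int \<lfloor>(real r * (real n - 4 - real r) - 3 * (real n - 1)) / 2\<rfloor>)"
proof -
  obtain N where n: "n = N + 1" using assms(1) by (metis Suc_eq_plus1 not0_implies_Suc not_numeral_le_zero)
  \<comment> \<open>One block of \<open>N\<close> vertices is set aside to merge with the remaining
    \<open>r\<close> in the second construction.\<close>
  obtain l where k: "k = Suc l" using assms(3) by (cases k) auto
  have N: "N \<ge> 14" "r + 8 \<le> N" using assms(1,5) n by auto
  have p: "p = Suc l * N + r" using assms(6) n k by simp
  define e1 where "e1 = Suc l * (N choose 2) + (r choose 2)"
  define e2 where "e2 = l * (N choose 2) + (N - 4) * (N + r) div 2"
  \<comment> \<open>This is \<open>r * (N - r) - 3 * (N + r)\<close>, the difference of the two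
    deficiencies, hence twice \<open>e2 - e1\<close> before rounding.\<close>
  define z where "z = int r * (int N - 3 - int r) - 3 * int N"
  have ex: "ex p (T3_vertices n) (T3_edges n) = max e1 e2"
    using ex_T3_eq_max[OF N(1) assms(4) N(2), of l] by (simp add: n p e1_def e2_def)
  have d1: "2 * int e1 = (int N - 1) * int p - int r * (int N - int r)"
    using clique_edge_counts(1)[of l N r] by (simp only: p e1_def)
  have "int e2 - int e1 = z div 2"
  proof -
    have "int ((N - 4) * (N + r)) = (int N - 4) * (int N + int r)"
      using N(1) by (simp add: of_nat_diff)
    moreover have "z = int r * (int N - int r) - 3 * (int N + int r)"
      by (simp add: z_def algebra_simps)
    ultimately have "2 * int (l * (N choose 2)) + int ((N - 4) * (N + r)) = 2 * int e1 + z"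
      using clique_edge_counts(2)[of l N r] unfolding d1 p[symmetric] by linarith
    moreover have "int e2 = int (l * (N choose 2)) + int ((N - 4) * (N + r)) div 2"
      by (simp add: e2_def zdiv_int)
    ultimately show ?thesis by linarith
  qed
  then have "real_of_int (int e2 - int e1) = real_of_int (z div 2)" by (rule arg_cong)
  then have diff: "real e2 - real e1 = real_of_int (z div 2)" by simp
  have fl: "\<lfloor>(real r * (real n - 4 - real r) - 3 * (real n - 1)) / 2\<rfloor> = z div 2"
  proof -
    have "(real r * (real n - 4 - real r) - 3 * (real n - 1)) / 2 = real_of_int z / real_of_int 2"
      by (simp add: z_def n)
    then show ?thesis by (simp only: floor_divide_of_int_eq)
  qed
  have e1: "((real n - 2) * real p - real r * (real n - 1 - real r)) / 2 = real e1"
  proof -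
    have "real_of_int (2 * int e1) = real_of_int ((int N - 1) * int p - int r * (int N - int r))"
      by (rule arg_cong[OF d1])
    then show ?thesis by (simp add: n)
  qed
  \<comment> \<open>The maximum of \<open>e1\<close> and \<open>e2\<close> is \<open>e1\<close> plus
    the positive part of their difference.\<close>
  show ?thesis unfolding ex fl e1 diff[symmetric] by (simp add: max_def)
qed

end
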